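(* Let $q$ be an odd prime and $y$ an integer that is not a multiple of $q$, and let $r$ be a positive integer. If $r\equiv0\pmod{q}$ then $w_{q+1}^{(r)}(y)\equiv0\pmod{q}$, and if $r\equiv-1\pmod{q}$ then $w_{q+1}^{(r)}(y)\equiv-y\pmod{q}$.
   Context: $w_{n}^{(r)}(y)=\sum_{k=0}^{n}\left\{{n\atop k}\right\}(r)_{k}\,y^{k}$, where $\left\{{n\atop k}\right\}$ are Stirling numbers of the second kind and $(x)_{k}=x(x+1)\cdots(x+k-1)$, $(x)_0=1$. *)

theory Defs
  imports "HOL-Combinatorics.Stirling" "HOL-Number_Theory.Cong"
begin

text \<open>
  The polynomials \<open>w\<^sub>n\<^sup>(\<^sup>r\<^sup>)(y)\<close>. In the library, \<open>Stirling\<close> denotes the Stirling numbers of the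
  second kind (lower-case \<open>stirling\<close> those of the first kind), and \<open>pochhammer r k\<close> is the
  rising factorial \<open>r (r + 1) \<dots> (r + k - 1)\<close>.
\<close>

definition w_poly :: "nat \<Rightarrow> 'a::comm_semiring_1 \<Rightarrow> 'a \<Rightarrow> 'a" where
  "w_poly n r y = (\<Sum>k=0..n. of_nat (Stirling n k) * pochhammer r k * y ^ k)"

end

theory Submission
  imports Defs
begin

text \<open>Since \<open>pochhammer r (k + 1) = r * pochhammer (r + 1) k\<close>, a factor
  \<open>r * y\<close> splits off the sum (\<open>w_poly_Suc\<close>), which settles r = 0 mod q. If
  r = -1 mod q, the remaining factors \<open>pochhammer (r + 1) k\<close> vanish for k > 0, so only
  \<open>r * y\<close>, that is -y, survives.\<close>

lemma w_poly_Suc: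
  "w_poly (Suc n) r y =
    r * y * (\<Sum>k=0..n. of_nat (Stirling (Suc n) (Suc k)) * pochhammer (r + 1) k * y ^ k)"
  \<comment> \<open>The split-off term k = 0 vanishes because
    \<open>Stirling (Suc n) 0 = 0\<close>.\<close>
  unfolding w_poly_def sum.atLeast0_atMost_Suc_shift
  by (simp add: sum_distrib_left pochhammer_rec algebra_simps del: Stirling.simps(4))

text \<open>Taking \<open>r + 1\<close> itself as modulus makes the vanishing a plain divisibility;
  the result then passes to any divisor of \<open>r + 1\<close>, such as q.\<close>

lemma w_poly_Suc_cong_mod_add_1:
  fixes r y :: int
  shows "[w_poly (Suc n) r y = r * y] (mod r + 1)"
proof -
  define f where
    "f k = of_nat (Stirling (Suc n) (Suc k)) * pochhammer (r + 1) k * y ^ k" for k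
  \<comment> \<open>\<open>f 0\<close> is \<open>Stirling (Suc n) 1 = 1\<close>; for k > 0 the
    rising factorial starts with the factor \<open>r + 1\<close>.\<close>
  have "[f k = (if k = 0 then 1 else 0)] (mod r + 1)" for k
    unfolding f_def
    by (cases k) (simp_all add: Stirling_1 pochhammer_rec cong_0_iff del: Stirling.simps(4))
  then have "[(\<Sum>k=0..n. f k) = (\<Sum>k=0..n. if k = 0 then 1 else 0)] (mod r + 1)"
    by (intro cong_sum)
  then have "[r * y * (\<Sum>k=0..n. f k) = r * y * 1] (mod r + 1)"
    by (intro cong_mult cong_refl) simp
  then show ?thesis
    by (simp add: w_poly_Suc f_def del: Stirling.simps)
qed

theorem theorem4p6:
  fixes q :: nat and y r :: int
  assumes "prime q" and "odd q"
    and "\<not> int q dvd y"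
    and "r > 0"
  shows "([r = 0] (mod int q) \<longrightarrow> [w_poly (q + 1) r y = 0] (mod int q))
    \<and> ([r = - 1] (mod int q) \<longrightarrow> [w_poly (q + 1) r y = - y] (mod int q))"
proof (intro conjI impI)
  assume "[r = 0] (mod int q)"
  then show "[w_poly (q + 1) r y = 0] (mod int q)"
    by (simp add: w_poly_Suc cong_0_iff del: Stirling.simps)
next
  assume r: "[r = - 1] (mod int q)"
  then have "int q dvd r + 1"
    by (simp add: cong_iff_dvd_diff)
  then have "[w_poly (q + 1) r y = r * y] (mod int q)"
    using cong_dvd_modulus[OF w_poly_Suc_cong_mod_add_1] by simp
  also have "[r * y = - 1 * y] (mod int q)"
    using r by (rule cong_scalar_right)
  finally show "[w_poly (q + 1) r y = - y] (mod int q)"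
    by simp
qed

end
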